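(* Let $\mathcal I\subset\mathbb C[\underline z]$ be a homogeneous ideal. If $\{q_1,\ldots,q_v\}$ is a minimal set of generators for $\mathcal I$ with the property that $\{[q_i^*]:1\le i\le v\}$ is a basis for $\tilde{\mathbb V}_0(\mathcal I)/\mathbb V_0(\mathcal I)$ (in particular $q_i^*\in\tilde{\mathbb V}_0(\mathcal I)$), then $q_1,\ldots,q_v$ is unique up to a linear transformation; that is, if $\{\tilde q_1,\ldots,\tilde q_v\}$ is another minimal set of generators for $\mathcal I$ with the same property, then there are constants $\alpha_{ij}\in\mathbb C$ such that $\tilde q_i=\sum_{j=1}^v\alpha_{ij}q_j$ for $1\le i\le v$.
   Context: $\mathbb C[\underline z]=\mathbb C[z_1,\ldots,z_m]$. For $q=\sum_\alpha a_\alpha z^\alpha$ put $q(D)=\sum_\alpha a_\alpha\,\partial^{|\alpha|}/\partial z_1^{\alpha_1}\cdots\partial z_m^{\alpha_m}$ and $q^*(z)=\overline{q(\bar z)}=\sum_\alpha\bar a_\alpha z^\alpha$. The characteristic space of $\mathcal I$ at $0$ is $\mathbb V_0(\mathcal I)=\{q\in\mathbb C[\underline z]: q(D)p|_0=0\text{ for all }p\in\mathcal I\}$, and $\tilde{\mathbb V}_0(\mathcal I)=\{q\in\mathbb C[\underline z]:\partial q/\partial z_i\in\mathbb V_0(\mathcal I),\ 1\le i\le m\}$. A set of generators is minimal if no proper subset generates. *)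

theory Defs
  imports Complex_Main "HOL-Library.Poly_Mapping" "HOL-Library.Set_Algebras"
begin

text \<open>
  The ring of complex polynomials in the variables \<open>z\<^sub>i\<close>, \<open>i\<close> ranging over the finite index type
  \<open>'n\<close> (so \<open>m = CARD('n)\<close>): finitely supported maps from exponent vectors to coefficients, with the
  convolution product of \<^theory>\<open>HOL-Library.Poly_Mapping\<close>.
\<close>

type_synonym 'n exponent = "'n \<Rightarrow>\<^sub>0 nat"
type_synonym 'n cpoly = "('n \<Rightarrow>\<^sub>0 nat) \<Rightarrow>\<^sub>0 complex"

definition const :: "complex \<Rightarrow> 'n cpoly" where
  "const c = Poly_Mapping.single 0 c"

definition eval :: "('n::finite) cpoly \<Rightarrow> ('n \<Rightarrow> complex) \<Rightarrow> complex" where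
  "eval p z = (\<Sum>\<alpha>\<in>Poly_Mapping.keys p.
     Poly_Mapping.lookup p \<alpha> * (\<Prod>i\<in>UNIV. z i ^ Poly_Mapping.lookup \<alpha> i))"

definition conj_poly :: "('n::finite) cpoly \<Rightarrow> 'n cpoly" where
  "conj_poly q = Poly_Mapping.map cnj q"

lemma lookup_conj_poly:
  "Poly_Mapping.lookup (conj_poly q) \<alpha> = cnj (Poly_Mapping.lookup q \<alpha>)"
  unfolding conj_poly_def by transfer (simp add: when_def)

lemma eval_conj_poly: "eval (conj_poly q) z = cnj (eval q (\<lambda>i. cnj (z i)))"
proof -
  have "Poly_Mapping.keys (conj_poly q) = Poly_Mapping.keys q"
    by (auto simp: in_keys_iff lookup_conj_poly)
  then show ?thesis
    by (simp add: eval_def lookup_conj_poly)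
qed


subsection \<open>Differential operators\<close>

text \<open>In the summand below, exponents with \<open>\<alpha>\<^sub>i = 0\<close> get the coefficient \<open>0\<close>, so the truncated
  subtraction of exponents is harmless.\<close>

definition partial :: "'n \<Rightarrow> ('n::finite) cpoly \<Rightarrow> 'n cpoly" where
  "partial i p = (\<Sum>\<alpha>\<in>Poly_Mapping.keys p.
     Poly_Mapping.single (\<alpha> - Poly_Mapping.single i 1)
       (of_nat (Poly_Mapping.lookup \<alpha> i) * Poly_Mapping.lookup p \<alpha>))"

text \<open>The partial derivatives are composed over all \<open>i\<close>; the order is irrelevant by
  \<open>comp_fun_commute_partial\<close> below.\<close>

definition multi_partial :: "'n exponent \<Rightarrow> ('n::finite) cpoly \<Rightarrow> 'n cpoly" where
  "multi_partial \<alpha> p = Finite_Set.fold (\<lambda>i. partial i ^^ Poly_Mapping.lookup \<alpha> i) p UNIV"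

definition diff_op :: "('n::finite) cpoly \<Rightarrow> 'n cpoly \<Rightarrow> 'n cpoly" where
  "diff_op q p = (\<Sum>\<alpha>\<in>Poly_Mapping.keys q. const (Poly_Mapping.lookup q \<alpha>) * multi_partial \<alpha> p)"

lemma lookup_partial:
  "Poly_Mapping.lookup (partial i p) \<beta> =
     of_nat (Suc (Poly_Mapping.lookup \<beta> i)) * Poly_Mapping.lookup p (\<beta> + Poly_Mapping.single i 1)"
proof -
  let ?e = "Poly_Mapping.single i (1::nat)"
  have eq: "Poly_Mapping.lookup (Poly_Mapping.single (\<alpha> - ?e)
        (of_nat (Poly_Mapping.lookup \<alpha> i) * Poly_Mapping.lookup p \<alpha>)) \<beta> =
      (if \<alpha> = \<beta> + ?e then of_nat (Suc (Poly_Mapping.lookup \<beta> i)) * Poly_Mapping.lookup p \<alpha> else 0)"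
    for \<alpha>
  proof (cases "Poly_Mapping.lookup \<alpha> i = 0")
    case True
    then have "\<alpha> \<noteq> \<beta> + ?e" by (auto simp: lookup_add)
    with True show ?thesis by simp
  next
    case False
    have "\<alpha> - ?e = \<beta> \<longleftrightarrow> \<alpha> = \<beta> + ?e"
    proof
      assume "\<alpha> - ?e = \<beta>"
      moreover have "\<alpha> - ?e + ?e = \<alpha>"
        using False by (intro poly_mapping_eqI)
          (auto simp: lookup_add lookup_minus lookup_single when_def)
      ultimately show "\<alpha> = \<beta> + ?e" by simp
    qed simp
    then show ?thesis
      by (auto simp: lookup_single when_def lookup_add algebra_simps)
  qed
  show ?thesis
    unfolding partial_def lookup_sum eq by (auto simp: sum.delta in_keys_iff)
qed

lemma partial_commute: "partial i (partial j p) = partial j (partial i p)"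
proof (cases "i = j")
  case False
  have "\<beta> + Poly_Mapping.single i 1 + Poly_Mapping.single j 1 =
      \<beta> + Poly_Mapping.single j 1 + Poly_Mapping.single i (1::nat)" for \<beta>
    by (simp only: ac_simps)
  with False show ?thesis
    by (intro poly_mapping_eqI) (simp add: lookup_partial lookup_add lookup_single)
qed simp

lemma comp_fun_commute_partial:
  "comp_fun_commute (\<lambda>i. partial i ^^ (k i) :: ('n::finite) cpoly \<Rightarrow> 'n cpoly)"
proof
  fix i j :: 'n
  have 1: "partial j ((partial i ^^ a) p) = (partial i ^^ a) (partial j p)"
    for a and p :: "'n cpoly"
    by (induction a) (simp_all add: partial_commute[of j i])
  have "(partial j ^^ b) ((partial i ^^ a) p) = (partial i ^^ a) ((partial j ^^ b) p)"
    for a b and p :: "'n cpoly"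
    by (induction b) (simp_all add: 1)
  then show "(partial j ^^ k j) \<circ> (partial i ^^ k i) =
      ((partial i ^^ k i) \<circ> (partial j ^^ k j) :: 'n cpoly \<Rightarrow> _)"
    by (simp add: fun_eq_iff)
qed


subsection \<open>Ideals\<close>

text \<open>A commutative ring is a module over itself; its submodules are the ideals, and
  \<open>ideal.span S\<close> is the ideal generated by \<open>S\<close>.\<close>

interpretation ideal: module "(*) :: ('a::comm_ring_1) \<Rightarrow> 'a \<Rightarrow> 'a"
  by standard (simp_all add: algebra_simps)

definition hom_component :: "nat \<Rightarrow> ('n::finite) cpoly \<Rightarrow> 'n cpoly" where
  "hom_component d p =
     (\<Sum>\<alpha> | \<alpha> \<in> Poly_Mapping.keys p \<and> (\<Sum>i\<in>UNIV. Poly_Mapping.lookup \<alpha> i) = d.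
        Poly_Mapping.single \<alpha> (Poly_Mapping.lookup p \<alpha>))"

definition homogeneous_ideal :: "('n::finite) cpoly set \<Rightarrow> bool" where
  "homogeneous_ideal I \<longleftrightarrow> ideal.subspace I \<and> (\<forall>p\<in>I. \<forall>d. hom_component d p \<in> I)"

definition minimal_generators :: "('n::finite) cpoly set \<Rightarrow> 'n cpoly set \<Rightarrow> bool" where
  "minimal_generators I S \<longleftrightarrow> ideal.span S = I \<and> (\<forall>T. T \<subset> S \<longrightarrow> ideal.span T \<noteq> I)"


subsection \<open>The characteristic space at the origin\<close>

definition char_space :: "('n::finite) cpoly set \<Rightarrow> 'n cpoly set" where
  "char_space I = {q. \<forall>p\<in>I. eval (diff_op q p) (\<lambda>_. 0) = 0}"

definition char_space_tilde :: "('n::finite) cpoly set \<Rightarrow> 'n cpoly set" where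
  "char_space_tilde I = {q. \<forall>i. partial i q \<in> char_space I}"

text \<open>The class of \<open>p\<close> modulo a subspace \<open>V\<close> is the coset \<open>p +o V\<close>, and the linear combination
  with coefficients \<open>c\<^sub>j\<close> of the classes of \<open>x\<^sub>j\<close> is the class of the sum of the \<open>c\<^sub>j x\<^sub>j\<close>. The
  predicate says that the classes of the finite family \<open>x\<^sub>j\<close>, \<open>j \<in> J\<close>, form a basis of \<open>W / V\<close>;
  as it concerns a family, the classes are in particular pairwise distinct.\<close>

definition quotient_basis ::
  "('n::finite) cpoly set \<Rightarrow> 'n cpoly set \<Rightarrow> 'j set \<Rightarrow> ('j \<Rightarrow> 'n cpoly) \<Rightarrow> bool" where
  "quotient_basis W V J x \<longleftrightarrow>
     (\<forall>j\<in>J. x j \<in> W) \<and>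
     (\<forall>c. (\<Sum>j\<in>J. const (c j) * x j) +o V = 0 +o V \<longrightarrow> (\<forall>j\<in>J. c j = 0)) \<and>
     (\<forall>w\<in>W. \<exists>c. w +o V = (\<Sum>j\<in>J. const (c j) * x j) +o V)"

end

theory Submission
  imports Defs
begin

text \<open>
  The pairing \<open>q(D)p\<close> evaluated at \<open>0\<close> is \<open>\<Sum>\<^sub>\<alpha> \<alpha>! q\<^sub>\<alpha> p\<^sub>\<alpha>\<close>. It is a symmetric bilinear form, called
  \<open>fischer\<close> below, and \<open>\<langle>p, q\<rangle> = fischer q\<^sup>* p\<close> is the Fischer inner product, which is positive
  definite (\<open>fischer_conj_self_eq_0_iff\<close>). For this form the adjoint of the derivative with respect
  to \<open>z\<^sub>i\<close> is the multiplication by \<open>z\<^sub>i\<close> (\<open>fischer_partial_left\<close>). Hence \<open>q\<^sup>*\<close> lies in the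
  characteristic space of an ideal \<open>I\<close> if and only if \<open>q\<close> is orthogonal to \<open>I\<close>, and it lies in the
  enlarged space \<open>char_space_tilde I\<close> if and only if \<open>q\<close> is orthogonal to \<open>\<mm>I\<close>, where \<open>\<mm>\<close> is the
  ideal of the polynomials that vanish at the origin.

  Let \<open>q\<^sub>1, \<dots>, q\<^sub>v\<close> generate \<open>I\<close> and be orthogonal to \<open>\<mm>I\<close>, and let \<open>p \<in> I\<close> be orthogonal to \<open>\<mm>I\<close>
  as well. Write \<open>p = \<Sum>\<^sub>j f\<^sub>j q\<^sub>j\<close> and split each \<open>f\<^sub>j\<close> into its value \<open>c\<^sub>j\<close> at the origin and a
  remainder in \<open>\<mm>\<close>. Then \<open>r = p - \<Sum>\<^sub>j c\<^sub>j q\<^sub>j\<close> lies in \<open>\<mm>I\<close> and is orthogonal to \<open>\<mm>I\<close>, so that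
  \<open>r = 0\<close> and \<open>p\<close> is a linear combination of the \<open>q\<^sub>j\<close> with constant coefficients
  (\<open>generator_combination_of_orthogonal\<close>). The theorem is this statement for each \<open>p = q'\<^sub>i\<close>.
\<close>

section \<open>Coefficients of polynomials and their derivatives\<close>

text \<open>For a ring as a module over itself, this rule is \<open>mult.assoc\<close> read from right to left, so the
  simplifier would loop with \<open>algebra_simps\<close>.\<close>

declare ideal.scale_scale [simp del]

lemma sum_monomials_eq:
  "(\<Sum>\<alpha>\<in>Poly_Mapping.keys p. Poly_Mapping.single \<alpha> (Poly_Mapping.lookup p \<alpha>)) = p"
  by (intro poly_mapping_eqI)
    (auto simp: lookup_sum lookup_single when_def sum.delta in_keys_iff)

lemma monomial_induct [case_names single sum]:
  fixes p :: "'a \<Rightarrow>\<^sub>0 'b::comm_monoid_add"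
  assumes single: "\<And>\<alpha> c. P (Poly_Mapping.single \<alpha> c)"
    and sum: "\<And>p p'. P p \<Longrightarrow> P p' \<Longrightarrow> P (p + p')"
  shows "P p"
proof -
  have "P 0"
    using single [of _ 0] by simp
  then have "P (\<Sum>\<alpha>\<in>A. Poly_Mapping.single \<alpha> (Poly_Mapping.lookup p \<alpha>))" for A
    by (induction A rule: infinite_finite_induct) (auto intro: single sum)
  then show ?thesis
    by (metis sum_monomials_eq)
qed

lemma lookup_const_times:
  "Poly_Mapping.lookup (const c * p) \<alpha> = c * Poly_Mapping.lookup p \<alpha>"
proof (induction p rule: monomial_induct)
  case (single \<beta> a)
  then show ?case by (simp add: const_def mult_single lookup_single when_def)
next
  case (sum p p')
  then show ?case by (simp add: lookup_add algebra_simps)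
qed

lemma eval_zero: "eval p (\<lambda>_. 0) = Poly_Mapping.lookup p (0 :: 'n::finite exponent)"
proof -
  have "(\<Prod>i\<in>UNIV. (0::complex) ^ Poly_Mapping.lookup \<alpha> i) = (if \<alpha> = 0 then 1 else 0)"
    for \<alpha> :: "'n exponent"
  proof (cases "\<alpha> = 0")
    case False
    then obtain i where "Poly_Mapping.lookup \<alpha> i \<noteq> 0"
      by (metis poly_mapping_eqI lookup_zero)
    with False show ?thesis by (auto intro!: prod_zero)
  qed simp
  then show ?thesis
    by (simp add: eval_def if_distrib [where f = "\<lambda>x. _ * x"] sum.delta in_keys_iff cong: if_cong)
qed

lemma lookup_partial_funpow:
  "Poly_Mapping.lookup ((partial i ^^ k) p) \<beta> =
     pochhammer (of_nat (Suc (Poly_Mapping.lookup \<beta> i))) k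
       * Poly_Mapping.lookup p (\<beta> + Poly_Mapping.single i k)"
proof (induction k arbitrary: \<beta>)
  case (Suc k)
  have "\<beta> + Poly_Mapping.single i 1 + Poly_Mapping.single i k =
      \<beta> + Poly_Mapping.single i (Suc k)"
    by (simp add: add.assoc flip: single_add)
  moreover have "Suc (Poly_Mapping.lookup (\<beta> + Poly_Mapping.single i 1) i) =
      Suc (Suc (Poly_Mapping.lookup \<beta> i))"
    by (simp add: lookup_add)
  ultimately show ?case
    by (simp only: funpow.simps comp_apply lookup_partial Suc.IH pochhammer_rec mult.assoc
        of_nat_Suc [of "Suc _"] add.commute [of 1])
qed simp

definition multi_fact :: "('n::finite) exponent \<Rightarrow> nat" where
  "multi_fact \<alpha> = (\<Prod>i\<in>UNIV. fact (Poly_Mapping.lookup \<alpha> i))"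

lemma multi_fact_pos: "multi_fact \<alpha> > 0"
  by (simp add: multi_fact_def prod_pos)

lemma multi_fact_add_single:
  "multi_fact (\<beta> + Poly_Mapping.single i 1) = Suc (Poly_Mapping.lookup \<beta> i) * multi_fact \<beta>"
proof -
  have "multi_fact (\<beta> + Poly_Mapping.single i 1) =
      (\<Prod>j\<in>UNIV. (if j = i then Suc (Poly_Mapping.lookup \<beta> i) else 1) * fact (Poly_Mapping.lookup \<beta> j))"
    unfolding multi_fact_def
    by (intro prod.cong) (auto simp: lookup_add lookup_single when_def)
  then show ?thesis
    unfolding multi_fact_def prod.distrib by simp
qed

text \<open>
  An induction over the variables that have been differentiated has to follow the coefficient at an
  arbitrary exponent \<open>\<beta>\<close>, because each derivative reads a coefficient at a shifted exponent; the
  factor at \<open>\<beta>\<close> is a product of Pochhammer symbols, which become factorials at \<open>\<beta> = 0\<close>.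
\<close>

lemma lookup_multi_partial_zero:
  "Poly_Mapping.lookup (multi_partial \<alpha> p) 0 =
     of_nat (multi_fact \<alpha>) * Poly_Mapping.lookup p \<alpha>"
proof -
  have fold: "Poly_Mapping.lookup
        (Finite_Set.fold (\<lambda>i. partial i ^^ Poly_Mapping.lookup \<alpha> i) p A) \<beta> =
      (\<Prod>i\<in>A. pochhammer (of_nat (Suc (Poly_Mapping.lookup \<beta> i))) (Poly_Mapping.lookup \<alpha> i))
        * Poly_Mapping.lookup p (\<beta> + (\<Sum>i\<in>A. Poly_Mapping.single i (Poly_Mapping.lookup \<alpha> i)))"
    for A :: "'a set" and \<beta>
    using finite[of A]
  proof (induction A arbitrary: \<beta> rule: finite_induct)
    case empty
    then show ?case by simp
  next
    case (insert j A)
    interpret comp_fun_commute "\<lambda>i. partial i ^^ Poly_Mapping.lookup \<alpha> i :: 'a cpoly \<Rightarrow> _"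
      by (rule comp_fun_commute_partial)
    let ?f = "\<lambda>i. partial i ^^ Poly_Mapping.lookup \<alpha> i :: 'a cpoly \<Rightarrow> _"
    let ?k = "Poly_Mapping.lookup \<alpha> j"
    let ?\<beta> = "\<beta> + Poly_Mapping.single j ?k"
    have "Poly_Mapping.lookup (Finite_Set.fold ?f p (insert j A)) \<beta> =
        pochhammer (of_nat (Suc (Poly_Mapping.lookup \<beta> j))) ?k
          * Poly_Mapping.lookup (Finite_Set.fold ?f p A) ?\<beta>"
      unfolding fold_insert [OF insert.hyps] by (rule lookup_partial_funpow)
    moreover have "(\<Prod>i\<in>A. pochhammer (of_nat (Suc (Poly_Mapping.lookup ?\<beta> i)))
            (Poly_Mapping.lookup \<alpha> i)) =
        (\<Prod>i\<in>A. pochhammer (of_nat (Suc (Poly_Mapping.lookup \<beta> i)))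
            (Poly_Mapping.lookup \<alpha> i) :: complex)"
      \<comment> \<open>The shift by a multiple of the unit vector of \<open>j\<close> is not seen by the variables in \<open>A\<close>.\<close>
      using insert.hyps by (intro prod.cong) (auto simp: lookup_add lookup_single when_def)
    ultimately show ?case
      unfolding insert.IH sum.insert [OF insert.hyps] prod.insert [OF insert.hyps]
      by (simp only: add.assoc mult.assoc)
  qed
  have "(\<Sum>i\<in>UNIV. Poly_Mapping.single i (Poly_Mapping.lookup \<alpha> i)) = \<alpha>"
    by (intro poly_mapping_eqI) (simp add: lookup_sum lookup_single when_def)
  then show ?thesis
    unfolding multi_partial_def by (simp add: fold multi_fact_def flip: pochhammer_fact)
qed

section \<open>The Fischer pairing\<close>

definition fischer :: "('n::finite) cpoly \<Rightarrow> 'n cpoly \<Rightarrow> complex" where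
  "fischer q p = eval (diff_op q p) (\<lambda>_. 0)"

text \<open>
  The set \<open>A\<close> is arbitrary above the support of \<open>q\<close>, so that two arguments can be summed over the
  union of their supports, which makes the symmetry of the pairing visible.
\<close>

lemma fischer_eq_sum:
  assumes "finite A" "Poly_Mapping.keys q \<subseteq> A"
  shows "fischer q p = (\<Sum>\<alpha>\<in>A. Poly_Mapping.lookup q \<alpha> *
    of_nat (multi_fact \<alpha>) * Poly_Mapping.lookup p \<alpha>)"
proof -
  have "fischer q p = (\<Sum>\<alpha>\<in>Poly_Mapping.keys q. Poly_Mapping.lookup q \<alpha> *
      of_nat (multi_fact \<alpha>) * Poly_Mapping.lookup p \<alpha>)"
    by (simp only: fischer_def eval_zero diff_op_def lookup_sum lookup_const_times
        lookup_multi_partial_zero mult.assoc)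
  also have "\<dots> = (\<Sum>\<alpha>\<in>A. Poly_Mapping.lookup q \<alpha> *
      of_nat (multi_fact \<alpha>) * Poly_Mapping.lookup p \<alpha>)"
    by (rule sum.mono_neutral_left [OF assms]) (simp add: in_keys_iff)
  finally show ?thesis .
qed

lemma fischer_commute: "fischer q p = fischer p q"
proof -
  let ?A = "Poly_Mapping.keys q \<union> Poly_Mapping.keys p"
  have "fischer q p = (\<Sum>\<alpha>\<in>?A. Poly_Mapping.lookup q \<alpha> *
    of_nat (multi_fact \<alpha>) * Poly_Mapping.lookup p \<alpha>)"
    by (rule fischer_eq_sum) auto
  also have "\<dots> = fischer p q"
    by (subst fischer_eq_sum [of ?A]) (simp_all add: mult_ac)
  finally show ?thesis .
qed

lemma fischer_add_right: "fischer q (p + p') = fischer q p + fischer q p'"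
  by (simp add: fischer_eq_sum [OF finite_keys order_refl] lookup_add algebra_simps sum.distrib)

lemma fischer_const_right: "fischer q (const c * p) = c * fischer q p"
  unfolding fischer_eq_sum [OF finite_keys order_refl] lookup_const_times sum_distrib_left
  by (simp only: mult_ac)

lemma fischer_add_left: "fischer (q + q') p = fischer q p + fischer q' p"
  by (metis fischer_add_right fischer_commute)

lemma fischer_const_left: "fischer (const c * q) p = c * fischer q p"
  by (metis fischer_const_right fischer_commute)

lemma fischer_zero_right: "fischer q 0 = 0"
  using fischer_add_right [of q 0 0] by simp

lemma fischer_sum_right: "fischer q (\<Sum>j\<in>J. f j) = (\<Sum>j\<in>J. fischer q (f j))"
proof (induction J rule: infinite_finite_induct)
  show "fischer q (\<Sum>j\<in>{}. f j) = (\<Sum>j\<in>{}. fischer q (f j))"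
    and "infinite A \<Longrightarrow> fischer q (\<Sum>j\<in>A. f j) = (\<Sum>j\<in>A. fischer q (f j))" for A
    by (simp_all add: fischer_zero_right)
qed (simp add: fischer_add_right)

lemma fischer_sum_left: "fischer (\<Sum>j\<in>J. f j) p = (\<Sum>j\<in>J. fischer (f j) p)"
  unfolding fischer_commute [of _ p] by (rule fischer_sum_right)

lemma fischer_single_right:
  "fischer q (Poly_Mapping.single \<alpha> c) =
     Poly_Mapping.lookup q \<alpha> * of_nat (multi_fact \<alpha>) * c"
  by (subst fischer_eq_sum [of "insert \<alpha> (Poly_Mapping.keys q)"])
    (auto simp: lookup_single when_def sum.delta if_distrib [where f = "\<lambda>x. _ * x"] cong: if_cong)

text \<open>
  On monomials this is the identity \<open>(\<beta> + e\<^sub>i)! = (\<beta>\<^sub>i + 1) \<beta>!\<close>: the factor \<open>\<beta>\<^sub>i + 1\<close> on the left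
  comes from the differentiation, on the right from the weight of the Fischer pairing.
\<close>

lemma fischer_partial_left:
  "fischer (partial i q) p = fischer q (Poly_Mapping.single (Poly_Mapping.single i 1) 1 * p)"
proof (induction p rule: monomial_induct)
  case (single \<beta> c)
  have "Poly_Mapping.single (Poly_Mapping.single i 1) 1 * Poly_Mapping.single \<beta> c =
      Poly_Mapping.single (\<beta> + Poly_Mapping.single i 1) c"
    by (simp add: mult_single add.commute)
  then show ?case
    by (simp only: fischer_single_right lookup_partial multi_fact_add_single of_nat_mult mult_ac)
next
  case (sum p p')
  then show ?case
    by (simp add: fischer_add_right distrib_left)
qed

text \<open>The pairing of \<open>r\<^sup>*\<close> with \<open>r\<close> is \<open>\<Sum>\<^sub>\<alpha> \<alpha>! |r\<^sub>\<alpha>|\<^sup>2\<close>, a sum of nonnegative terms.\<close>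

lemma fischer_conj_self_eq_0_iff: "fischer (conj_poly r) r = 0 \<longleftrightarrow> r = 0"
proof
  assume "fischer (conj_poly r) r = 0"
  moreover have "cnj z * of_nat n * z = of_real (of_nat n * (cmod z)\<^sup>2)" for z n
    unfolding of_real_mult of_real_of_nat_eq complex_norm_square by (simp only: mult_ac)
  then have "fischer (conj_poly r) r =
      (\<Sum>\<alpha>\<in>Poly_Mapping.keys r. of_real (of_nat (multi_fact \<alpha>) * (cmod (Poly_Mapping.lookup r \<alpha>))\<^sup>2))"
    by (subst fischer_eq_sum [of "Poly_Mapping.keys r"])
      (auto simp only: finite_keys in_keys_iff lookup_conj_poly complex_cnj_zero_iff)
  ultimately have "complex_of_real
      (\<Sum>\<alpha>\<in>Poly_Mapping.keys r. of_nat (multi_fact \<alpha>) * (cmod (Poly_Mapping.lookup r \<alpha>))\<^sup>2) = 0"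
    by (simp only: of_real_sum)
  then have "\<forall>\<alpha>\<in>Poly_Mapping.keys r. of_nat (multi_fact \<alpha>) * (cmod (Poly_Mapping.lookup r \<alpha>))\<^sup>2 = (0::real)"
    unfolding of_real_eq_0_iff by (subst (asm) sum_nonneg_eq_0_iff) auto
  then have "Poly_Mapping.lookup r \<alpha> = 0" if "\<alpha> \<in> Poly_Mapping.keys r" for \<alpha>
    using that multi_fact_pos [of \<alpha>] by auto
  then show "r = 0"
    by (intro poly_mapping_eqI) (metis in_keys_iff lookup_zero)
qed (simp add: fischer_zero_right)

section \<open>Elements of an ideal orthogonal to its product with the maximal ideal\<close>

text \<open>
  The condition on \<open>g\<close> says that every monomial of \<open>g\<close> is divisible by some variable \<open>z\<^sub>i\<close>. For a
  monomial \<open>z\<^sub>i m\<close> the adjoint relation moves \<open>z\<^sub>i\<close> to \<open>q\<close> as a derivative, which annihilates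
  \<open>m p \<in> I\<close>.
\<close>

lemma fischer_char_space_tilde_eq_0:
  assumes "ideal.subspace I" "q \<in> char_space_tilde I" "p \<in> I" "Poly_Mapping.lookup g 0 = 0"
  shows "fischer q (g * p) = 0"
proof -
  have monomial: "fischer q (Poly_Mapping.single \<alpha> c * p) = 0" if "\<alpha> \<noteq> 0" for \<alpha> c
  proof -
    from that obtain i where "Poly_Mapping.lookup \<alpha> i \<noteq> 0"
      by (metis poly_mapping_eqI lookup_zero)
    then have "Poly_Mapping.single i 1 + (\<alpha> - Poly_Mapping.single i 1) = \<alpha>"
      by (intro poly_mapping_eqI) (auto simp: lookup_add lookup_minus lookup_single when_def)
    then have "Poly_Mapping.single \<alpha> c * p = Poly_Mapping.single (Poly_Mapping.single i 1) 1 *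
        (Poly_Mapping.single (\<alpha> - Poly_Mapping.single i 1) c * p)"
      by (simp add: mult_single flip: mult.assoc)
    moreover have "Poly_Mapping.single (\<alpha> - Poly_Mapping.single i 1) c * p \<in> I"
      using assms(1,3) by (rule ideal.subspace_scale)
    ultimately show ?thesis
      using assms(2) unfolding char_space_tilde_def char_space_def fischer_def [symmetric]
      by (simp only: fischer_partial_left [symmetric]) blast
  qed
  have "g * p = (\<Sum>\<alpha>\<in>Poly_Mapping.keys g. Poly_Mapping.single \<alpha> (Poly_Mapping.lookup g \<alpha>)) * p"
    by (simp add: sum_monomials_eq)
  also have "\<dots> = (\<Sum>\<alpha>\<in>Poly_Mapping.keys g. Poly_Mapping.single \<alpha> (Poly_Mapping.lookup g \<alpha>) * p)"
    by (rule sum_distrib_right)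
  finally show ?thesis
    using assms(4) by (auto simp: fischer_sum_right in_keys_iff intro!: sum.neutral monomial)
qed

text \<open>
  The coefficients are indexed by \<open>J\<close> and not by the set of generators, because \<open>q\<close> may take the same
  value at several indices.
\<close>

lemma ideal_span_imageE:
  fixes q :: "'j \<Rightarrow> 'a::comm_ring_1"
  assumes "p \<in> ideal.span (q ` J)" "finite J"
  obtains f where "p = (\<Sum>j\<in>J. f j * q j)"
proof -
  have "\<exists>f. p = (\<Sum>j\<in>J. f j * q j)"
    using assms(1)
  proof (induction rule: ideal.span_induct_alt)
    case base
    show ?case by (rule exI [of _ "\<lambda>_. 0"]) simp
  next
    case (step c x y)
    then obtain k f where "k \<in> J" "x = q k" "y = (\<Sum>j\<in>J. f j * q j)" by auto
    with assms(2) have "c * x + y = (\<Sum>j\<in>J. ((if j = k then c else 0) + f j) * q j)"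
      by (simp add: distrib_right sum.distrib if_distrib [where f = "\<lambda>x. x * _"] cong: if_cong)
    then show ?case by (rule exI [of _ "\<lambda>j. (if j = k then c else 0) + f j"])
  qed
  with that show ?thesis by blast
qed

text \<open>
  Modulo the product of \<open>I\<close> with the maximal ideal of the origin, the coefficients of the generators
  in \<open>p\<close> may be replaced by their constant terms; the error belongs to that product and is at the same
  time orthogonal to it, hence zero.
\<close>

lemma generator_combination_of_orthogonal:
  fixes q :: "'j \<Rightarrow> ('n::finite) cpoly"
  assumes "finite J" "ideal.span (q ` J) = I"
    and q: "\<And>j. j \<in> J \<Longrightarrow> conj_poly (q j) \<in> char_space_tilde I"
    and p: "p \<in> I" "conj_poly p \<in> char_space_tilde I"
  shows "\<exists>c. p = (\<Sum>j\<in>J. const (c j) * q j)"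
proof -
  have I: "ideal.subspace I"
    using assms(2) by auto
  have qI: "q j \<in> I" if "j \<in> J" for j
    using assms(2) that by (auto intro: ideal.span_base)
  obtain f where f: "p = (\<Sum>j\<in>J. f j * q j)"
    using p(1) assms(1,2) by (auto elim: ideal_span_imageE)
  define c where "c j = Poly_Mapping.lookup (f j) 0" for j
  define g where "g j = f j - const (c j)" for j
  define r where "r = p - (\<Sum>j\<in>J. const (c j) * q j)"
  have r: "r = (\<Sum>j\<in>J. g j * q j)"
    unfolding r_def f g_def by (simp add: left_diff_distrib sum_subtractf)
  have g: "Poly_Mapping.lookup (g j) 0 = 0" for j
    by (simp add: g_def c_def const_def lookup_minus)
  have orth: "fischer u r = 0" if "u \<in> char_space_tilde I" for u
    unfolding r fischer_sum_right
    using that I qI g by (intro sum.neutral ballI fischer_char_space_tilde_eq_0) auto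
  have "conj_poly r = conj_poly p + (\<Sum>j\<in>J. const (- cnj (c j)) * conj_poly (q j))"
    by (intro poly_mapping_eqI)
      (simp add: r_def lookup_conj_poly lookup_minus lookup_add lookup_sum lookup_const_times sum_negf)
  then have "fischer (conj_poly r) r = 0"
    by (simp add: orth p(2) q fischer_add_left fischer_sum_left fischer_const_left)
  then have "r = 0"
    by (simp add: fischer_conj_self_eq_0_iff)
  then show ?thesis
    by (auto simp: r_def)
qed

theorem proposition2p10:
  fixes I :: "('n::finite) cpoly set"
    and v :: nat
    and q q' :: "nat \<Rightarrow> 'n cpoly"
  assumes "homogeneous_ideal I"
    and "minimal_generators I (q ` {1..v})"
    and "quotient_basis (char_space_tilde I) (char_space I) {1..v} (\<lambda>i. conj_poly (q i))"
    and "minimal_generators I (q' ` {1..v})"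
    and "quotient_basis (char_space_tilde I) (char_space I) {1..v} (\<lambda>i. conj_poly (q' i))"
  shows "\<exists>\<alpha> :: nat \<Rightarrow> nat \<Rightarrow> complex.
           \<forall>i\<in>{1..v}. q' i = (\<Sum>j\<in>{1..v}. const (\<alpha> i j) * q j)"
proof -
  have "\<exists>c. q' i = (\<Sum>j\<in>{1..v}. const (c j) * q j)" if "i \<in> {1..v}" for i
  proof (rule generator_combination_of_orthogonal)
    show "q' i \<in> I"
      using assms(4) that by (auto simp: minimal_generators_def intro: ideal.span_base)
  qed (use assms(2,3,5) that in \<open>auto simp: minimal_generators_def quotient_basis_def\<close>)
  then show ?thesis by metis
qed

end
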